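(* Let $G$ be a graph with $n$ vertices, maximum degree $\Delta\ge 2$, and girth $g$, where $g$ is odd and $g\ge 5$. If $S$ is a $\frac{g-1}{2}$-distance mutual-visibility set of $G$ and the induced subgraph $G[S]$ contains some edge, then $$|S|\le 2+(\Delta-1)^{(g-1)/2}.$$
   Context: All graphs are finite, simple, undirected and connected. The girth is the length of a shortest cycle. For a graph $G$, a set $S\subseteq V(G)$ and an integer $k\ge 1$, two vertices $x,y$ are $S_k$-visible if there is a shortest $x,y$-path of length at most $k$ none of whose internal vertices lies in $S$. $S$ is a $k$-distance mutual-visibility set if every two vertices of $S$ are $S_k$-visible. *)

theory Defs
  imports "Graph_Theory.Graph_Theory" "HOL-Library.Extended_Nat"
begin

text \<open>
  Finite simple graphs are the locale \<open>graph\<close> of Graph\_Theory: finite symmetric digraphs without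
  loops and parallel arcs, so an undirected edge is a pair of opposite arcs.  Each neighbour of \<open>v\<close>
  accounts for exactly one arc leaving \<open>v\<close>, hence the degree of \<open>v\<close> is its out-degree.
\<close>

definition max_degree :: "('a, 'b) pre_digraph \<Rightarrow> nat" where
  "max_degree G = Max (out_degree G ` verts G)"

text \<open>
  The library's \<open>cycle\<close> also admits the closed walk \<open>a, b, a\<close> that runs back and forth along one
  edge; the length bound excludes it.
\<close>

definition graph_cycle :: "('a, 'b) pre_digraph \<Rightarrow> 'b awalk \<Rightarrow> bool" where
  "graph_cycle G c \<longleftrightarrow> pre_digraph.cycle G c \<and> 3 \<le> length c"

text \<open>The girth of an acyclic graph is \<open>\<infinity>\<close>.\<close>

definition girth :: "('a, 'b) pre_digraph \<Rightarrow> enat" where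
  "girth G = (INF c \<in> {c. graph_cycle G c}. enat (length c))"

definition shortest_path :: "('a, 'b) pre_digraph \<Rightarrow> 'a \<Rightarrow> 'b awalk \<Rightarrow> 'a \<Rightarrow> bool" where
  "shortest_path G x p y \<longleftrightarrow>
     pre_digraph.apath G x p y \<and> (\<forall>q. pre_digraph.apath G x q y \<longrightarrow> length p \<le> length q)"

definition internal_verts :: "('a, 'b) pre_digraph \<Rightarrow> 'a \<Rightarrow> 'b awalk \<Rightarrow> 'a \<Rightarrow> 'a set" where
  "internal_verts G x p y = set (pre_digraph.awalk_verts G x p) - {x, y}"

definition visible :: "('a, 'b) pre_digraph \<Rightarrow> 'a set \<Rightarrow> nat \<Rightarrow> 'a \<Rightarrow> 'a \<Rightarrow> bool" where
  "visible G S k x y \<longleftrightarrow>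
     (\<exists>p. shortest_path G x p y \<and> length p \<le> k \<and> internal_verts G x p y \<inter> S = {})"

definition distance_mutual_visibility_set :: "('a, 'b) pre_digraph \<Rightarrow> nat \<Rightarrow> 'a set \<Rightarrow> bool" where
  "distance_mutual_visibility_set G k S \<longleftrightarrow>
     S \<subseteq> verts G \<and> (\<forall>x \<in> S. \<forall>y \<in> S. x \<noteq> y \<longrightarrow> visible G S k x y)"

end

theory Submission
  imports Defs
begin

text \<open>
  Let \<open>k = (g - 1) / 2\<close> and let \<open>xy\<close> be an edge of \<open>G[S]\<close>.  For \<open>z \<in> S - {x, y}\<close> there are a path
  \<open>p\<close> from \<open>x\<close> to \<open>z\<close> avoiding \<open>y\<close> and a path \<open>q\<close> from \<open>y\<close> to \<open>z\<close> avoiding \<open>x\<close>, both of length at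
  most \<open>k\<close>.  Then \<open>yx\<close> followed by \<open>p\<close> is a path from \<open>y\<close> to \<open>z\<close> different from \<open>q\<close>, so there is a
  cycle of length at most \<open>1 + |p| + |q|\<close>.  As \<open>g = 2k + 1\<close>, this forces \<open>|p| = k\<close>.  Hence every
  such \<open>z\<close> is the end of a path of length exactly \<open>k\<close> that starts at \<open>x\<close> and avoids the
  neighbour \<open>y\<close>, and there are at most \<open>(\<Delta> - 1)^k\<close> such ends.
\<close>

text \<open>Reversal replaces every arc by an opposite one, so it is the vertex list, not the arc
  list, that gets reversed. Needed to close two paths with common ends into a cycle.\<close>

lemma (in sym_digraph) reverse_awalk:
  assumes "awalk u p v"
  obtains r where "awalk v r u" "awalk_verts v r = rev (awalk_verts u p)" "length r = length p"
proof -
  have "\<exists>r. awalk v r u \<and> awalk_verts v r = rev (awalk_verts u p) \<and> length r = length p"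
    using assms
  proof (induction p arbitrary: u)
    case Nil
    then show ?case by (intro exI[of _ "[]"]) (auto simp: awalk_simps)
  next
    case (Cons e p)
    then have e: "e \<in> arcs G" "u = tail G e" and p: "awalk (head G e) p v"
      by (auto simp: awalk_simps)
    obtain r where r: "awalk v r (head G e)" "awalk_verts v r = rev (awalk_verts (head G e) p)"
      "length r = length p"
      using Cons.IH[OF p] by blast
    obtain e' where e': "e' \<in> arcs G" "tail G e' = head G e" "head G e' = tail G e"
      using e(1) sym_arcs by (auto simp: symmetric_conv)
    have "awalk (head G e) [e'] (tail G e)"
      using e' e by (auto simp: awalk_simps)
    then have "awalk v (r @ [e']) u"
      using r(1) e(2) by (simp only: awalk_appendI)
    moreover from this have "awalk_verts v (r @ [e']) = awalk_verts v r @ [tail G e]"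
      using r(1) e' by (subst awalk_verts_append) auto
    ultimately show ?case
      using r e by (intro exI[of _ "r @ [e']"]) auto
  qed
  then show ?thesis using that by blast
qed

text \<open>Induction on the total length. At a common inner vertex both paths split, and the two
  initial or the two final pieces differ; without such a vertex, \<open>p\<close> followed by the
  reverse of \<open>q\<close> is itself a cycle.\<close>

lemma (in graph) distinct_apaths_imp_cycle:
  assumes "apath u p v" "apath u q v" "p \<noteq> q"
  shows "\<exists>c. graph_cycle G c \<and> length c \<le> length p + length q"
  using assms
proof (induction "length p + length q" arbitrary: u v p q rule: less_induct)
  case less
  have p: "awalk u p v" and dp: "distinct (awalk_verts u p)"
    and q: "awalk u q v" and dq: "distinct (awalk_verts u q)"
    using less.prems by (auto simp: apath_def)
  show ?case
  proof (cases "\<exists>w. w \<in> set (awalk_verts u p) \<inter> set (awalk_verts u q) \<and> w \<noteq> u \<and> w \<noteq> v")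
    case True
    then obtain w where w: "w \<in> set (awalk_verts u p)" "w \<in> set (awalk_verts u q)"
      "w \<noteq> u" "w \<noteq> v" by blast
    obtain p1 p2 where p12: "p = p1 @ p2" "awalk u p1 w" "awalk w p2 v"
      using awalk_decomp[OF p w(1)] by blast
    obtain q1 q2 where q12: "q = q1 @ q2" "awalk u q1 w" "awalk w q2 v"
      using awalk_decomp[OF q w(2)] by blast
    have ap: "apath u p1 w" "apath w p2 v"
      using less.prems(1) p12 by (auto simp: apath_append_iff)
    have aq: "apath u q1 w" "apath w q2 v"
      using less.prems(2) q12 by (auto simp: apath_append_iff)
    \<comment> \<open>Proper pieces of \<open>p\<close> alone already make both totals drop,
      whatever the pieces of \<open>q\<close> are.\<close>
    have "p1 \<noteq> []" "p2 \<noteq> []"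
      using p12 w by (auto simp: awalk_simps)
    then have "length p1 + length q1 < length p + length q"
      "length p2 + length q2 < length p + length q"
      using p12(1) q12(1) by auto
    moreover have "p1 \<noteq> q1 \<or> p2 \<noteq> q2"
      using less.prems(3) p12(1) q12(1) by blast
    ultimately obtain c where "graph_cycle G c"
      "length c \<le> length p1 + length q1 \<or> length c \<le> length p2 + length q2"
      using less.hyps ap aq by blast
    then show ?thesis
      using p12(1) q12(1) by (intro exI[of _ c]) auto
  next
    case False
    \<comment> \<open>Otherwise both paths would be empty and hence equal.\<close>
    have "u \<noteq> v"
      using less.prems apath_nonempty_ends by metis
    then have ne: "p \<noteq> []" "q \<noteq> []"
      using p q by (auto simp: awalk_simps)
    obtain r where r: "awalk v r u" "awalk_verts v r = rev (awalk_verts u q)"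
      "length r = length q"
      using reverse_awalk[OF q] .
    obtain vp where vp: "awalk_verts u p = u # vp"
      using p by (cases "awalk_verts u p") auto
    obtain vq where vq: "awalk_verts u q = vq @ [v]"
      using q awalk_verts_non_Nil[of u q]
      by (metis append_butlast_last_id awlast_of_awalk awalkE')
    have walk: "awalk u (p @ r) u"
      using p r(1) by (rule awalk_appendI)
    have "awalk_verts u (p @ r) = awalk_verts u p @ tl (awalk_verts v r)"
      using awalk_verts_append[OF walk] p by auto
    then have tl: "tl (awalk_verts u (p @ r)) = vp @ rev vq"
      by (simp add: vp vq r(2))
    \<comment> \<open>\<open>vp\<close> lacks \<open>u\<close> and \<open>vq\<close> lacks
      \<open>v\<close>, so a common element would be a shared inner vertex.\<close>
    have "set vp \<inter> set vq = {}"
      using False dp dq vp vq by auto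
    then have "distinct (tl (awalk_verts u (p @ r)))"
      using dp dq by (simp add: tl vp vq)
    \<comment> \<open>The only shorter case is a pair of single arcs from \<open>u\<close> to
      \<open>v\<close>, and these coincide because there are no parallel arcs.\<close>
    moreover have "3 \<le> length (p @ r)"
    proof (rule ccontr)
      assume "\<not> 3 \<le> length (p @ r)"
      moreover have "length p \<noteq> 0" "length q \<noteq> 0" using ne by auto
      ultimately have "length p = 1" "length q = 1"
        using r(3) unfolding length_append by linarith+
      then obtain e f where "p = [e]" "q = [f]"
        by (auto simp: length_Suc_conv)
      then show False
        using p q less.prems(3) no_multi_arcs[of e f]
        by (auto simp: awalk_simps arc_to_ends_def)
    qed
    ultimately have "graph_cycle G (p @ r)"
      using walk ne by (auto simp: graph_cycle_def cycle_def)
    then show ?thesis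
      using r(3) by (intro exI[of _ "p @ r"]) auto
  qed
qed

text \<open>Avoiding \<open>y\<close> rules out \<open>e\<close> as first arc, which leaves at most
  \<open>d - 1\<close> choices. After a first arc \<open>f\<close>, the rest of the path avoids
  \<open>x\<close>, a neighbour of its new start, so the induction continues with
  \<open>head G f\<close> and \<open>x\<close> in place of \<open>x\<close> and
  \<open>y\<close>.\<close>

lemma (in graph) card_apath_ends_avoiding_neighbour:
  assumes deg: "\<And>w. w \<in> verts G \<Longrightarrow> out_degree G w \<le> d"
  assumes "e \<in> arcs G" "tail G e = x" "head G e = y"
  shows "card {z. \<exists>p. apath x p z \<and> length p = k \<and> y \<notin> set (awalk_verts x p)} \<le> (d - 1) ^ k"
  using assms(2-)
proof (induction k arbitrary: e x y)
  case 0
  have "{z. \<exists>p. apath x p z \<and> length p = 0 \<and> y \<notin> set (awalk_verts x p)} \<subseteq> {x}"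
    by (auto simp: apath_simps)
  from card_mono[OF _ this] show ?case by simp
next
  case (Suc k)
  define N where "N x y = {z. \<exists>p. apath x p z \<and> length p = k \<and> y \<notin> set (awalk_verts x p)}" for x y
  have fin: "finite (out_arcs G x - {e})" by auto
  have sub: "{z. \<exists>p. apath x p z \<and> length p = Suc k \<and> y \<notin> set (awalk_verts x p)}
      \<subseteq> (\<Union>f \<in> out_arcs G x - {e}. N (head G f) x)"
  proof clarify
    fix z p
    assume *: "apath x p z" "length p = Suc k" "y \<notin> set (awalk_verts x p)"
    then obtain f q where p: "p = f # q" "length q = k" by (cases p) auto
    have f: "f \<in> arcs G" "tail G f = x" "apath (head G f) q z" "x \<notin> set (awalk_verts (head G f) q)"
      using * p by (auto simp: apath_simps)
    have "head G f \<in> set (awalk_verts (head G f) q)"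
      using f(3) by (rule hd_in_awalk_verts)
    then have "f \<noteq> e" using * p Suc.prems by auto
    then show "z \<in> (\<Union>f \<in> out_arcs G x - {e}. N (head G f) x)"
      using f p by (auto simp: N_def)
  qed
  have N: "card (N (head G f) x) \<le> (d - 1) ^ k" if f: "f \<in> out_arcs G x - {e}" for f
  proof -
    \<comment> \<open>The arc opposite to \<open>f\<close> takes the role of \<open>e\<close> in the
      induction hypothesis.\<close>
    obtain f' where "f' \<in> arcs G" "tail G f' = head G f" "head G f' = x"
      using f sym_arcs by (auto simp: symmetric_conv)
    then show ?thesis unfolding N_def by (rule Suc.IH)
  qed
  have "finite (\<Union>f \<in> out_arcs G x - {e}. N (head G f) x)"
  proof (rule finite_subset[OF _ finite_verts])
    show "(\<Union>f \<in> out_arcs G x - {e}. N (head G f) x) \<subseteq> verts G"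
      by (auto simp: N_def apath_def dest: awalk_last_in_verts)
  qed
  then have "card {z. \<exists>p. apath x p z \<and> length p = Suc k \<and> y \<notin> set (awalk_verts x p)}
      \<le> card (\<Union>f \<in> out_arcs G x - {e}. N (head G f) x)"
    using sub by (rule card_mono)
  also have "\<dots> \<le> (\<Sum>f \<in> out_arcs G x - {e}. card (N (head G f) x))"
    using fin by (rule card_UN_le)
  also have "\<dots> \<le> card (out_arcs G x - {e}) * (d - 1) ^ k"
    using sum_bounded_above[of "out_arcs G x - {e}" _ "(d - 1) ^ k"] N by auto
  also have "card (out_arcs G x - {e}) \<le> d - 1"
    using deg[of x] Suc.prems by (auto simp: out_degree_def)
  finally show ?case by simp
qed

text \<open>The paths \<open>e # p\<close> and \<open>q\<close> share their ends but differ, since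
  only the former visits \<open>x\<close>; together they yield a short cycle.\<close>

lemma (in graph) girth_le_via_edge:
  assumes girth: "girth G = enat g" and e: "e \<in> arcs G" "tail G e = y" "head G e = x"
  assumes p: "apath x p z" "y \<notin> set (awalk_verts x p)"
    and q: "apath y q z" "x \<notin> set (awalk_verts y q)"
  shows "g \<le> 1 + length p + length q"
proof -
  have "apath y (e # p) z"
    using e p by (auto simp: apath_simps)
  moreover have "x \<in> set (awalk_verts y (e # p))"
    using e p hd_in_awalk_verts(2) by auto
  then have "e # p \<noteq> q" using q(2) by auto
  ultimately obtain c where c: "graph_cycle G c" "length c \<le> length (e # p) + length q"
    using distinct_apaths_imp_cycle[OF _ q(1)] by blast
  have "girth G \<le> enat (length c)"
    unfolding girth_def using c(1) by (auto intro: INF_lower)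
  then show ?thesis using c(2) by (simp add: girth)
qed

theorem theorem5p4:
  fixes G :: "('a, 'b) pre_digraph" and S :: "'a set" and n \<Delta> g :: nat
  assumes "graph G" and "connected G"
    and "card (verts G) = n"
    and "max_degree G = \<Delta>" and "\<Delta> \<ge> 2"
    and "girth G = enat g" and "odd g" and "g \<ge> 5"
    and "distance_mutual_visibility_set G ((g - 1) div 2) S"
    and "arcs (G \<restriction> S) \<noteq> {}"
  shows "card S \<le> 2 + (\<Delta> - 1) ^ ((g - 1) div 2)"
proof -
  interpret graph G by fact
  define k where "k = (g - 1) div 2"
  have g: "g = 2 * k + 1"
    using \<open>odd g\<close> by (auto simp: k_def)
  have S: "S \<subseteq> verts G"
    and vis: "\<And>a b. a \<in> S \<Longrightarrow> b \<in> S \<Longrightarrow> a \<noteq> b \<Longrightarrow> visible G S k a b"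
    using assms(9) by (auto simp: distance_mutual_visibility_set_def k_def)
  obtain e where e: "e \<in> arcs G" "tail G e \<in> S" "head G e \<in> S"
    using assms(10) by auto
  define x y where "x = tail G e" and "y = head G e"
  obtain e' where e': "e' \<in> arcs G" "tail G e' = y" "head G e' = x"
    using e(1) sym_arcs by (auto simp: symmetric_conv x_def y_def)
  have xy: "x \<in> S" "y \<in> S" using e by (auto simp: x_def y_def)
  define N where "N = {z. \<exists>p. apath x p z \<and> length p = k \<and> y \<notin> set (awalk_verts x p)}"
  \<comment> \<open>Since \<open>b\<close> lies in \<open>S\<close> and is not an end, a path
    witnessing visibility of \<open>a\<close> and \<open>z\<close> cannot pass through it.\<close>
  have path: "\<exists>p. apath a p z \<and> length p \<le> k \<and> b \<notin> set (awalk_verts a p)"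
    if "a \<in> S" "b \<in> S" "z \<in> S" "a \<noteq> b" "z \<noteq> a" "z \<noteq> b" for a b z
    using vis[of a z] that by (auto simp: visible_def shortest_path_def internal_verts_def)
  have "x \<noteq> y" using no_loops e(1) by (auto simp: x_def y_def)
  have "S - {x, y} \<subseteq> N"
  proof
    fix z assume z: "z \<in> S - {x, y}"
    obtain p where p: "apath x p z" "length p \<le> k" "y \<notin> set (awalk_verts x p)"
      using path[of x y z] xy \<open>x \<noteq> y\<close> z by auto
    obtain q where q: "apath y q z" "length q \<le> k" "x \<notin> set (awalk_verts y q)"
      using path[of y x z] xy \<open>x \<noteq> y\<close> z by auto
    have "g \<le> 1 + length p + length q"
      using girth_le_via_edge[OF assms(6) e' p(1,3) q(1,3)] .
    then show "z \<in> N" using p q(2) g by (auto simp: N_def)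
  qed
  moreover have "finite N"
    by (rule finite_subset[OF _ finite_verts])
      (auto simp: N_def apath_def dest: awalk_last_in_verts)
  moreover have "out_degree G w \<le> \<Delta>" if "w \<in> verts G" for w
    using that assms(4) by (auto simp: max_degree_def)
  then have "card N \<le> (\<Delta> - 1) ^ k"
    unfolding N_def using e(1)
    by (rule card_apath_ends_avoiding_neighbour) (simp_all add: x_def y_def)
  ultimately have "card (S - {x, y}) \<le> (\<Delta> - 1) ^ k"
    by (meson card_mono le_trans)
  moreover have "card S \<le> card (S - {x, y}) + card {x, y}"
    using diff_card_le_card_Diff[of "{x, y}" S] by simp
  ultimately show ?thesis
    using \<open>x \<noteq> y\<close> by (simp add: k_def)
qed

end
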